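(* Let $(\Omega,\mu)$ be a measure space, $\mathcal{H}_1,\mathcal{H}_2$ right quaternionic Hilbert spaces, $K_1\in\mathbb{B}(\mathcal{H}_1)$ and $K_2\in\mathbb{B}(\mathcal{H}_2)$. Let $F_1:\Omega\to\mathcal{H}_1$ and $F_2:\Omega\to\mathcal{H}_2$ be mappings. If $F:=F_1\oplus F_2:\Omega\to\mathcal{H}_1\oplus\mathcal{H}_2$ is a continuous $K_1\oplus K_2$-frame for $\mathcal{H}_1\oplus\mathcal{H}_2$, then $F_1$ is a continuous $K_1$-frame for $\mathcal{H}_1$ and $F_2$ is a continuous $K_2$-frame for $\mathcal{H}_2$.
   Context: $\mathbb{H}$ denotes the quaternions. A right quaternionic Hilbert space is a right $\mathbb{H}$-vector space $\mathcal{H}$ with an inner product $\langle\cdot,\cdot\rangle:\mathcal{H}\times\mathcal{H}\to\mathbb{H}$ such that $\langle u,v\rangle=\overline{\langle v,u\rangle}$, $\langle v,v\rangle>0$ for $v\neq0$, additive in the second variable with $\langle v,uq\rangle=\langle v,u\rangle q$ for $q\in\mathbb{H}$, and complete for $\|u\|=\sqrt{\langle u,u\rangle}$. $\mathbb{B}(\mathcal{H})$ is the set of bounded right $\mathbb{H}$-linear operators on $\mathcal{H}$; $L^*$ is the adjoint of $L$. For $K\in\mathbb{B}(\mathcal{H})$, a weakly measurable $F:\Omega\to\mathcal{H}$ (i.e. $\omega\mapsto\langle F(\omega),u\rangle$ is measurable for each $u$) is a continuous $K$-frame for $\mathcal{H}$ if there are $0<A\leq B<\infty$ with $A\|K^*u\|^2\leq\int_\Omega|\langle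 F(\omega),u\rangle|^2d\mu(\omega)\leq B\|u\|^2$ for all $u\in\mathcal{H}$. $\mathcal{H}_1\oplus\mathcal{H}_2$ is the direct sum with inner product $\langle u_1\oplus v_1,u_2\oplus v_2\rangle=\langle u_1,u_2\rangle+\langle v_1,v_2\rangle$; $(K_1\oplus K_2)(u\oplus v)=K_1u\oplus K_2v$; $(F_1\oplus F_2)(\omega)=F_1(\omega)\oplus F_2(\omega)$. *)

theory Defs
  imports "HOL-Analysis.Analysis"
begin

section \<open>The quaternions\<close>

text \<open>\<open>Quat a b c d\<close> is \<open>a + b i + c j + d k\<close> with \<open>i\<^sup>2 = j\<^sup>2 = k\<^sup>2 = i j k = -1\<close>.\<close>

codatatype quat = Quat (qre: real) (qi: real) (qj: real) (qk: real)

lemma quat_eq_iff: "x = y \<longleftrightarrow> qre x = qre y \<and> qi x = qi y \<and> qj x = qj y \<and> qk x = qk y"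
  by (auto intro: quat.expand)

instantiation quat :: ab_group_add
begin

primcorec zero_quat where
  "qre 0 = 0" | "qi 0 = 0" | "qj 0 = 0" | "qk 0 = 0"

primcorec plus_quat where
  "qre (x + y) = qre x + qre y"
| "qi (x + y) = qi x + qi y"
| "qj (x + y) = qj x + qj y"
| "qk (x + y) = qk x + qk y"

primcorec uminus_quat where
  "qre (- x) = - qre x"
| "qi (- x) = - qi x"
| "qj (- x) = - qj x"
| "qk (- x) = - qk x"

primcorec minus_quat where
  "qre (x - y) = qre x - qre y"
| "qi (x - y) = qi x - qi y"
| "qj (x - y) = qj x - qj y"
| "qk (x - y) = qk x - qk y"

instance
  by standard (simp_all add: quat_eq_iff)

end

instantiation quat :: ring_1
begin

primcorec one_quat where
  "qre 1 = 1" | "qi 1 = 0" | "qj 1 = 0" | "qk 1 = 0"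

primcorec times_quat where
  "qre (x * y) = qre x * qre y - qi x * qi y - qj x * qj y - qk x * qk y"
| "qi (x * y) = qre x * qi y + qi x * qre y + qj x * qk y - qk x * qj y"
| "qj (x * y) = qre x * qj y - qi x * qk y + qj x * qre y + qk x * qi y"
| "qk (x * y) = qre x * qk y + qi x * qj y - qj x * qi y + qk x * qre y"

instance
  by standard (simp_all add: quat_eq_iff algebra_simps)

end

instantiation quat :: real_algebra_1
begin

primcorec scaleR_quat where
  "qre (scaleR r x) = r * qre x"
| "qi (scaleR r x) = r * qi x"
| "qj (scaleR r x) = r * qj x"
| "qk (scaleR r x) = r * qk x"

instance
  by standard (simp_all add: quat_eq_iff algebra_simps)

end

primcorec qcnj :: "quat \<Rightarrow> quat" where
  "qre (qcnj x) = qre x"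
| "qi (qcnj x) = - qi x"
| "qj (qcnj x) = - qj x"
| "qk (qcnj x) = - qk x"

instantiation quat :: division_ring
begin

definition inverse_quat :: "quat \<Rightarrow> quat" where
  "inverse_quat x = inverse ((qre x)\<^sup>2 + (qi x)\<^sup>2 + (qj x)\<^sup>2 + (qk x)\<^sup>2) *\<^sub>R qcnj x"

definition divide_quat :: "quat \<Rightarrow> quat \<Rightarrow> quat" where
  "divide_quat x y = x * inverse y"

instance
proof
  fix x y :: quat
  let ?n = "(qre x)\<^sup>2 + (qi x)\<^sup>2 + (qj x)\<^sup>2 + (qk x)\<^sup>2"
  show "inverse (0 :: quat) = 0"
    by (simp add: inverse_quat_def quat_eq_iff)
  show "x div y = x * inverse y"
    by (rule divide_quat_def)
  assume "x \<noteq> 0"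
  then have n: "?n \<noteq> 0"
    by (simp add: quat_eq_iff add_nonneg_eq_0_iff)
  have "qcnj x * x = ?n *\<^sub>R 1" "x * qcnj x = ?n *\<^sub>R 1"
    by (simp_all add: quat_eq_iff power2_eq_square)
  with n show "inverse x * x = 1" "x * inverse x = 1"
    by (simp_all add: inverse_quat_def)
qed

end

instance quat :: real_div_algebra ..

instantiation quat :: real_normed_div_algebra
begin

definition norm_quat :: "quat \<Rightarrow> real" where
  "norm_quat x = sqrt ((qre x)\<^sup>2 + (qi x)\<^sup>2 + (qj x)\<^sup>2 + (qk x)\<^sup>2)"

definition sgn_quat :: "quat \<Rightarrow> quat" where
  "sgn_quat x = x /\<^sub>R norm x"

definition dist_quat :: "quat \<Rightarrow> quat \<Rightarrow> real" where
  "dist_quat x y = norm (x - y)"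

definition uniformity_quat :: "(quat \<times> quat) filter" where
  "uniformity_quat = (INF e\<in>{0 <..}. principal {(x, y). dist x y < e})"

definition open_quat :: "quat set \<Rightarrow> bool" where
  "open_quat U \<longleftrightarrow> (\<forall>x\<in>U. eventually (\<lambda>(x', y). x' = x \<longrightarrow> y \<in> U) uniformity)"

instance
proof
  fix r :: real and x y :: quat
  have norm_prod: "norm z = norm (qre z, qi z, qj z, qk z)" for z :: quat
    by (simp add: norm_quat_def norm_prod_def add.assoc)
  show "(norm x = 0) = (x = 0)"
    by (simp add: norm_quat_def quat_eq_iff add_nonneg_eq_0_iff)
  show "norm (x + y) \<le> norm x + norm y"
    using norm_triangle_ineq[of "(qre x, qi x, qj x, qk x)" "(qre y, qi y, qj y, qk y)"]
    by (simp add: norm_prod)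
  show "norm (scaleR r x) = \<bar>r\<bar> * norm x"
    using norm_scaleR[of r "(qre x, qi x, qj x, qk x)"]
    by (simp add: norm_prod)
  show "norm (x * y) = norm x * norm y"
    by (simp add: norm_quat_def real_sqrt_mult [symmetric]) (simp add: power2_eq_square algebra_simps)
qed (rule sgn_quat_def dist_quat_def open_quat_def uniformity_quat_def)+

end

section \<open>Right quaternionic Hilbert spaces\<close>

text \<open>
  \<open>qscale u q\<close> is the right multiple \<open>u q\<close>. The norm, the real scaling and the completeness
  come from \<^class>\<open>banach\<close>; the last two axioms force them to be the ones determined by the
  quaternionic structure, so they impose nothing beyond completeness for \<open>\<parallel>u\<parallel> = sqrt \<langle>u, u\<rangle>\<close>.
  By \<open>qinner_commute\<close> the quaternion \<open>\<langle>u, u\<rangle>\<close> is real, i.e. equal to its real part.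
\<close>

class right_quat_hilbert = banach +
  fixes qscale :: "'a \<Rightarrow> quat \<Rightarrow> 'a"
    and qinner :: "'a \<Rightarrow> 'a \<Rightarrow> quat"
  assumes qscale_add_left: "qscale (u + v) q = qscale u q + qscale v q"
    and qscale_add_right: "qscale u (p + q) = qscale u p + qscale u q"
    and qscale_qscale: "qscale (qscale u p) q = qscale u (p * q)"
    and qscale_one: "qscale u 1 = u"
    and qinner_commute: "qinner u v = qcnj (qinner v u)"
    and qinner_pos: "v \<noteq> 0 \<Longrightarrow> 0 < qre (qinner v v)"
    and qinner_add_right: "qinner v (u + w) = qinner v u + qinner v w"
    and qinner_qscale_right: "qinner v (qscale u q) = qinner v u * q"
    and scaleR_eq_qscale: "r *\<^sub>R u = qscale u (of_real r)"
    and norm_eq_sqrt_qinner: "norm u = sqrt (qre (qinner u u))"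

lemma qcnj_add: "qcnj (x + y) = qcnj x + qcnj y"
  by (simp add: quat_eq_iff)

lemma qinner_self_eq_of_real:
  fixes u :: "'a::right_quat_hilbert"
  shows "qinner u u = of_real ((norm u)\<^sup>2)"
proof -
  have im: "qi (qinner u u) = 0" "qj (qinner u u) = 0" "qk (qinner u u) = 0"
    using arg_cong[OF qinner_commute[of u u], of qi]
      arg_cong[OF qinner_commute[of u u], of qj]
      arg_cong[OF qinner_commute[of u u], of qk] by simp_all
  have "qinner 0 (0::'a) = 0"
    using qinner_add_right[of "0::'a" 0 0] by simp
  then have "0 \<le> qre (qinner u u)"
    using qinner_pos[of u] by (cases "u = 0") auto
  then show ?thesis
    using im by (simp add: quat_eq_iff of_real_def norm_eq_sqrt_qinner)
qed

lemma qre_qinner_self: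
  fixes u :: "'a::right_quat_hilbert"
  shows "qre (qinner u u) = (norm u)\<^sup>2"
  by (simp add: qinner_self_eq_of_real of_real_def)

text \<open>The direct sum, carried by the product type.\<close>

instantiation prod :: (right_quat_hilbert, right_quat_hilbert) right_quat_hilbert
begin

definition qscale_prod :: "'a \<times> 'b \<Rightarrow> quat \<Rightarrow> 'a \<times> 'b" where
  "qscale_prod u q = (qscale (fst u) q, qscale (snd u) q)"

definition qinner_prod :: "'a \<times> 'b \<Rightarrow> 'a \<times> 'b \<Rightarrow> quat" where
  "qinner_prod u v = qinner (fst u) (fst v) + qinner (snd u) (snd v)"

instance
proof
  fix u v w :: "'a \<times> 'b" and p q :: quat and r :: real
  show "qscale (u + v) q = qscale u q + qscale v q"
    by (simp add: qscale_prod_def qscale_add_left)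
  show "qscale u (p + q) = qscale u p + qscale u q"
    by (simp add: qscale_prod_def qscale_add_right)
  show "qscale (qscale u p) q = qscale u (p * q)"
    by (simp add: qscale_prod_def qscale_qscale)
  show "qscale u 1 = u"
    by (simp add: qscale_prod_def qscale_one)
  show "qinner u v = qcnj (qinner v u)"
    unfolding qinner_prod_def qcnj_add
    by (metis qinner_commute)
  show "qinner v (u + w) = qinner v u + qinner v w"
    by (simp add: qinner_prod_def qinner_add_right algebra_simps)
  show "qinner v (qscale u q) = qinner v u * q"
    by (simp add: qinner_prod_def qscale_prod_def qinner_qscale_right distrib_right)
  show "r *\<^sub>R u = qscale u (of_real r)"
    by (simp add: qscale_prod_def scaleR_prod_def scaleR_eq_qscale)
  show "norm u = sqrt (qre (qinner u u))"
    by (simp add: qinner_prod_def norm_prod_def qre_qinner_self)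
  show "v \<noteq> 0 \<Longrightarrow> 0 < qre (qinner v v)"
    by (cases v) (auto simp: qinner_prod_def qre_qinner_self zero_prod_def
        intro: add_pos_nonneg add_nonneg_pos)
qed

end

section \<open>Bounded operators and adjoints\<close>

definition bounded_qlinear :: "('a::right_quat_hilbert \<Rightarrow> 'b::right_quat_hilbert) \<Rightarrow> bool" where
  "bounded_qlinear L \<longleftrightarrow>
     (\<forall>u v. L (u + v) = L u + L v) \<and>
     (\<forall>u q. L (qscale u q) = qscale (L u) q) \<and>
     (\<exists>C. \<forall>u. norm (L u) \<le> C * norm u)"

text \<open>
  For a bounded right-linear operator on complete spaces the description is satisfied by exactly
  one operator (Riesz representation); elsewhere \<open>qadjoint\<close> has no intended meaning.
\<close>

definition qadjoint ::
  "('a::right_quat_hilbert \<Rightarrow> 'b::right_quat_hilbert) \<Rightarrow> 'b \<Rightarrow> 'a" where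
  "qadjoint L = (THE G. \<forall>u v. qinner (L u) v = qinner u (G v))"

section \<open>Continuous K-frames\<close>

text \<open>
  The integral is a Lebesgue integral with values in \<open>[0, \<infinity>]\<close>, so its finiteness is part of the
  upper bound. Measurability of quaternion-valued functions refers to the Borel sets of
  \<^typ>\<open>quat\<close>.
\<close>

definition weakly_measurable :: "'w measure \<Rightarrow> ('w \<Rightarrow> 'a::right_quat_hilbert) \<Rightarrow> bool" where
  "weakly_measurable M F \<longleftrightarrow> (\<forall>u. (\<lambda>\<omega>. qinner (F \<omega>) u) \<in> borel_measurable M)"

definition continuous_K_frame ::
  "'w measure \<Rightarrow> ('a::right_quat_hilbert \<Rightarrow> 'a) \<Rightarrow> ('w \<Rightarrow> 'a) \<Rightarrow> bool" where
  "continuous_K_frame M K F \<longleftrightarrow>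
     weakly_measurable M F \<and>
     (\<exists>A B :: real. 0 < A \<and> A \<le> B \<and>
       (\<forall>u. ennreal (A * (norm (qadjoint K u))\<^sup>2) \<le> (\<integral>\<^sup>+ \<omega>. ennreal ((norm (qinner (F \<omega>) u))\<^sup>2) \<partial>M) \<and>
            (\<integral>\<^sup>+ \<omega>. ennreal ((norm (qinner (F \<omega>) u))\<^sup>2) \<partial>M) \<le> ennreal (B * (norm u)\<^sup>2)))"

end

theory Submission
  imports Defs
begin

text \<open>
  The frame inequalities for the direct sum, read on the vectors \<open>u \<oplus> 0\<close>, are those for the first
  summand: \<open>\<langle>F\<^sub>1 \<oplus> F\<^sub>2, u \<oplus> 0\<rangle> = \<langle>F\<^sub>1, u\<rangle>\<close>, the norm of \<open>u \<oplus> 0\<close> is the norm of \<open>u\<close>, and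
  \<open>(K\<^sub>1 \<oplus> K\<^sub>2)\<^sup>* (u \<oplus> 0)\<close> has \<open>K\<^sub>1\<^sup>* u\<close> as its first component, so its norm dominates
  \<open>\<parallel>K\<^sub>1\<^sup>* u\<parallel>\<close>. The frame bounds \<open>A\<close> and \<open>B\<close> are thus inherited, and symmetrically for the second
  summand.

  The substance lies in \<open>(K\<^sub>1 \<oplus> K\<^sub>2)\<^sup>* = K\<^sub>1\<^sup>* \<oplus> K\<^sub>2\<^sup>*\<close> (\<open>qadjoint_map_prod\<close>). The adjoint is given by
  a definite description, so nothing can be said about it before an operator satisfying the
  adjoint equation is known to exist, and this is the Riesz representation theorem
  (\<open>riesz_representation\<close>). Only the real part of the inner product enters its analytic core: a
  bounded real-linear functional \<open>\<phi>\<close> is represented by the point at which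
  \<open>\<parallel>v\<parallel>\<^sup>2 - 2 \<phi> v\<close> is minimal (\<open>real_riesz_representation\<close>), and right-linearity over the quaternions
  then recovers the three imaginary components.
\<close>

section \<open>The real part of the inner product\<close>

lemma qinner_add_left:
  fixes u v w :: "'a::right_quat_hilbert"
  shows "qinner (u + v) w = qinner u w + qinner v w"
  by (metis qinner_commute qinner_add_right qcnj_add)

lemma qinner_zero_right [simp]: "qinner u (0::'a::right_quat_hilbert) = 0"
  using qinner_add_right[of u 0 0] by simp

lemma qinner_diff_left:
  fixes u v w :: "'a::right_quat_hilbert"
  shows "qinner (u - v) w = qinner u w - qinner v w"
  using qinner_add_left[of "u - v" v w] by (simp add: algebra_simps)

lemma qinner_left_eqI:
  fixes g h :: "'a::right_quat_hilbert"
  assumes "\<And>v. qinner g v = qinner h v"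
  shows "g = h"
proof -
  have "qinner (g - h) (g - h) = 0"
    using assms by (simp add: qinner_diff_left)
  then show ?thesis
    using qre_qinner_self[of "g - h"] by simp
qed

lemma qre_qinner_commute: "qre (qinner u v) = qre (qinner v (u::'a::right_quat_hilbert))"
  by (metis qinner_commute qcnj.simps(1))

lemma qre_qinner_scaleR_right:
  "qre (qinner u (r *\<^sub>R v)) = r * qre (qinner u (v::'a::right_quat_hilbert))"
  by (simp add: scaleR_eq_qscale qinner_qscale_right of_real_def)

lemma norm_add_sq:
  fixes u v :: "'a::right_quat_hilbert"
  shows "(norm (u + v))\<^sup>2 = (norm u)\<^sup>2 + 2 * qre (qinner u v) + (norm v)\<^sup>2"
  using qre_qinner_commute[of u v]
  by (simp add: qre_qinner_self [symmetric] qinner_add_left qinner_add_right)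

text \<open>The triangle inequality is an axiom for the norm, so squaring it gives the upper bound on the
  real part; the lower bound is the upper bound for \<open>- v\<close>.\<close>

lemma abs_qre_qinner_le:
  fixes u v :: "'a::right_quat_hilbert"
  shows "\<bar>qre (qinner u v)\<bar> \<le> norm u * norm v"
proof -
  have le: "qre (qinner u w) \<le> norm u * norm w" for w
    using power_mono[OF norm_triangle_ineq[of u w], of 2] norm_add_sq[of u w]
    by (simp add: power2_sum)
  have "qre (qinner u (- v)) = - qre (qinner u v)"
    using qre_qinner_scaleR_right[of u "-1" v] by simp
  then show ?thesis
    using le[of v] le[of "- v"] by simp
qed

lemma parallelogram_law:
  fixes u v :: "'a::right_quat_hilbert"
  shows "(norm (u + v))\<^sup>2 + (norm (u - v))\<^sup>2 = 2 * (norm u)\<^sup>2 + 2 * (norm v)\<^sup>2"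
  using norm_add_sq[of u v] norm_add_sq[of u "- v"] qre_qinner_scaleR_right[of u "-1" v]
  by simp

section \<open>Riesz representation\<close>

text \<open>
  The parallelogram law makes \<open>J v = \<parallel>v\<parallel>\<^sup>2 - 2 \<phi> v\<close> so convex that its minimizing sequences are
  Cauchy. By completeness the minimum is attained, and the vanishing of the first variation at the
  minimizer is the representation formula.
\<close>

lemma real_riesz_representation:
  fixes \<phi> :: "'a::right_quat_hilbert \<Rightarrow> real"
  assumes "bounded_linear \<phi>"
  shows "\<exists>g. \<forall>v. \<phi> v = qre (qinner g v)"
proof -
  interpret \<phi>: bounded_linear \<phi> by fact
  define J where "J v = (norm v)\<^sup>2 - 2 * \<phi> v" for v
  define m where "m = Inf (range J)"
  obtain C where C: "\<And>v. norm (\<phi> v) \<le> norm v * C"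
    using \<phi>.bounded by blast
  have "- C\<^sup>2 \<le> J v" for v
    using C[of v] zero_le_power2[of "norm v - C"]
    by (simp add: J_def power2_diff)
  then have bdd: "bdd_below (range J)"
    by (intro bdd_belowI2)
  have m_le: "m \<le> J v" for v
    unfolding m_def using bdd by (simp add: cInf_lower)
  have dist_le: "(norm (u - v))\<^sup>2 \<le> 2 * ((J u - m) + (J v - m))" for u v
  proof -
    have "J ((1/2) *\<^sub>R (u + v)) = (norm (u + v))\<^sup>2 / 4 - (\<phi> u + \<phi> v)"
      by (simp add: J_def \<phi>.scaleR \<phi>.add power_mult_distrib power_divide add_divide_distrib
          del: scaleR_add_right)
    then show ?thesis
      using m_le[of "(1/2) *\<^sub>R (u + v)"] parallelogram_law[of u v] by (simp add: J_def)
  qed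
  have "\<exists>v. J v < m + inverse (real (Suc n))" for n
    using cInf_lessD[of "range J" "m + inverse (real (Suc n))"] by (auto simp: m_def)
  then obtain x where x: "\<And>n. J (x n) < m + inverse (real (Suc n))"
    by metis
  have "Cauchy x"
  proof (rule CauchyI)
    fix e :: real
    assume "0 < e"
    then obtain N where N: "inverse (real (Suc N)) < e\<^sup>2 / 4"
      using reals_Archimedean[of "e\<^sup>2 / 4"] by auto
    have close: "J (x n) - m < e\<^sup>2 / 4" if "N \<le> n" for n
    proof -
      have "inverse (real (Suc n)) \<le> inverse (real (Suc N))"
        using that by (intro le_imp_inverse_le) auto
      then show ?thesis
        using x[of n] N by linarith
    qed
    have "norm (x i - x k) < e" if "N \<le> i" "N \<le> k" for i k
    proof (rule power2_less_imp_less)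
      show "(norm (x i - x k))\<^sup>2 < e\<^sup>2"
        using dist_le[of "x i" "x k"] close[OF that(1)] close[OF that(2)] by argo
    qed (use \<open>0 < e\<close> in simp)
    then show "\<exists>N. \<forall>i\<ge>N. \<forall>k\<ge>N. norm (x i - x k) < e"
      by blast
  qed
  then obtain g where g: "x \<longlonglongrightarrow> g"
    by (auto simp: Cauchy_convergent_iff convergent_def)
  have "(\<lambda>n. J (x n)) \<longlonglongrightarrow> J g"
    unfolding J_def by (intro tendsto_intros \<phi>.tendsto g)
  moreover have "(\<lambda>n. m + inverse (real (Suc n))) \<longlonglongrightarrow> m"
    using tendsto_add[OF tendsto_const[of m] LIMSEQ_inverse_real_of_nat] by simp
  ultimately have "J g \<le> m"
    using x by (blast intro: LIMSEQ_le less_imp_le)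
  then have min: "J g \<le> J v" for v
    using m_le[of v] by linarith
  have "\<phi> v = qre (qinner g v)" for v
  proof -
    define d where "d = \<phi> v - qre (qinner g v)"
    have expand: "J (g + t *\<^sub>R v) = J g + t\<^sup>2 * (norm v)\<^sup>2 - 2 * t * d" for t
      by (simp add: J_def d_def norm_add_sq qre_qinner_scaleR_right \<phi>.add \<phi>.scaleR
          power_mult_distrib algebra_simps)
    \<comment> \<open>The step minimizing the quadratic in \<open>t\<close> is \<open>d / \<parallel>v\<parallel>\<^sup>2\<close>; the added \<open>1\<close> avoids the case \<open>v = 0\<close>.\<close>
    define s where "s = (norm v)\<^sup>2 + 1"
    have s: "0 < s" "(norm v)\<^sup>2 = s - 1"
      unfolding s_def by (simp_all add: add_nonneg_pos)
    have "0 \<le> (d / s)\<^sup>2 * (norm v)\<^sup>2 - 2 * (d / s) * d"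
      using min[of "g + (d / s) *\<^sub>R v"] expand[of "d / s"] by linarith
    also have "\<dots> = - ((d / s)\<^sup>2 * (s + 1))"
      unfolding s(2) using s(1) by (simp add: field_simps power2_eq_square)
    finally have "(d / s)\<^sup>2 * (s + 1) \<le> 0"
      by simp
    then have "d = 0"
      using s(1) by (simp add: mult_le_0_iff)
    then show ?thesis
      by (simp add: d_def)
  qed
  then show ?thesis
    by blast
qed

text \<open>
  The real part of \<open>x q\<close>, for \<open>q\<close> running through the units \<open>1, i, j, k\<close>, gives the components of
  \<open>x\<close> up to sign.
\<close>

lemma quat_eqI_qre_mult:
  assumes "\<And>q. qre (x * q) = qre (y * q)"
  shows "x = y"
  using assms[of 1] assms[of "Quat 0 1 0 0"] assms[of "Quat 0 0 1 0"] assms[of "Quat 0 0 0 1"]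
  by (simp add: quat_eq_iff)

text \<open>A right-linear functional is determined by its real part, because the real part of
  \<open>f v * q\<close> is its real part at the vector \<open>v q\<close>. Hence representing the real part suffices.\<close>

lemma riesz_representation:
  fixes f :: "'a::right_quat_hilbert \<Rightarrow> quat"
  assumes add: "\<And>u v. f (u + v) = f u + f v"
    and scale: "\<And>v q. f (qscale v q) = f v * q"
    and bound: "\<And>v. \<bar>qre (f v)\<bar> \<le> C * norm v"
  shows "\<exists>g. \<forall>v. f v = qinner g v"
proof -
  have "bounded_linear (\<lambda>v. qre (f v))"
    by (rule bounded_linear_intro[where K = C])
      (use bound in \<open>simp_all add: add scale scaleR_eq_qscale of_real_def mult.commute\<close>)
  then obtain g where g: "\<And>v. qre (f v) = qre (qinner g v)"
    using real_riesz_representation by blast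
  have "f v = qinner g v" for v
  proof (rule quat_eqI_qre_mult)
    show "qre (f v * q) = qre (qinner g v * q)" for q
      using g[of "qscale v q"] by (simp only: scale qinner_qscale_right)
  qed
  then show ?thesis
    by blast
qed

section \<open>The adjoint of a direct sum\<close>

lemma qadjoint_eqI:
  assumes "\<And>u v. qinner (L u) v = qinner u (G v)"
  shows "qadjoint L = G"
  unfolding qadjoint_def
proof (rule the_equality)
  fix H
  assume H: "\<forall>u v. qinner (L u) v = qinner u (H v)"
  show "H = G"
  proof
    fix v
    show "H v = G v"
      by (rule qinner_left_eqI) (metis H assms qinner_commute)
  qed
qed (use assms in blast)

lemma qinner_qadjoint:
  fixes L :: "'a::right_quat_hilbert \<Rightarrow> 'b::right_quat_hilbert"
  assumes "bounded_qlinear L"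
  shows "qinner (L u) v = qinner u (qadjoint L v)"
proof -
  obtain C where add: "\<And>u v. L (u + v) = L u + L v"
    and scale: "\<And>u q. L (qscale u q) = qscale (L u) q"
    and C: "\<And>u. norm (L u) \<le> C * norm u"
    using assms unfolding bounded_qlinear_def by blast
  have "\<exists>g. \<forall>u. qinner w (L u) = qinner g u" for w
  proof (rule riesz_representation)
    show "\<bar>qre (qinner w (L u))\<bar> \<le> (norm w * C) * norm u" for u
      using abs_qre_qinner_le[of w "L u"] mult_left_mono[OF C[of u] norm_ge_zero[of w]]
      by (simp add: mult.assoc)
  qed (simp_all add: add scale qinner_add_right qinner_qscale_right)
  then obtain G where "\<And>w u. qinner w (L u) = qinner (G w) u"
    by metis
  then have G: "qinner (L u) w = qinner u (G w)" for u w
    by (metis qinner_commute)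
  then show ?thesis
    using qadjoint_eqI[of L G] by simp
qed

lemma qadjoint_map_prod:
  assumes "bounded_qlinear K1" "bounded_qlinear K2"
  shows "qadjoint (map_prod K1 K2) = map_prod (qadjoint K1) (qadjoint K2)"
  by (rule qadjoint_eqI) (simp add: qinner_prod_def qinner_qadjoint assms)

section \<open>Restricting a frame to a summand\<close>

text \<open>
  What the two summands have in common: \<open>\<iota>\<close> stands for the embedding \<open>u \<mapsto> u \<oplus> 0\<close> or \<open>v \<mapsto> 0 \<oplus> v\<close>, and
  \<open>F'\<close> for the corresponding component of the frame \<open>F\<close>.
\<close>

lemma continuous_K_frame_restrict:
  assumes frame: "continuous_K_frame M K F"
    and inner: "\<And>\<omega> u. qinner (F \<omega>) (\<iota> u) = qinner (F' \<omega>) u"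
    and isometry: "\<And>u. norm (\<iota> u) = norm u"
    and adjoint: "\<And>u. norm (qadjoint K' u) \<le> norm (qadjoint K (\<iota> u))"
  shows "continuous_K_frame M K' F'"
proof -
  obtain A B where meas: "weakly_measurable M F" and AB: "0 < A" "A \<le> B"
    and lower: "\<And>w. ennreal (A * (norm (qadjoint K w))\<^sup>2)
        \<le> (\<integral>\<^sup>+ \<omega>. ennreal ((norm (qinner (F \<omega>) w))\<^sup>2) \<partial>M)"
    and upper: "\<And>w. (\<integral>\<^sup>+ \<omega>. ennreal ((norm (qinner (F \<omega>) w))\<^sup>2) \<partial>M) \<le> ennreal (B * (norm w)\<^sup>2)"
    using frame unfolding continuous_K_frame_def by blast
  have "weakly_measurable M F'"
    unfolding weakly_measurable_def
  proof
    show "(\<lambda>\<omega>. qinner (F' \<omega>) u) \<in> borel_measurable M" for u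
      using meas[unfolded weakly_measurable_def, rule_format, of "\<iota> u"] by (simp only: inner)
  qed
  moreover have "ennreal (A * (norm (qadjoint K' u))\<^sup>2)
      \<le> (\<integral>\<^sup>+ \<omega>. ennreal ((norm (qinner (F' \<omega>) u))\<^sup>2) \<partial>M)" for u
  proof -
    have "ennreal (A * (norm (qadjoint K' u))\<^sup>2) \<le> ennreal (A * (norm (qadjoint K (\<iota> u)))\<^sup>2)"
      using AB(1) adjoint by (intro ennreal_leI mult_left_mono power_mono) auto
    also have "\<dots> \<le> (\<integral>\<^sup>+ \<omega>. ennreal ((norm (qinner (F' \<omega>) u))\<^sup>2) \<partial>M)"
      using lower[of "\<iota> u"] by (simp only: inner)
    finally show ?thesis .
  qed
  moreover have "(\<integral>\<^sup>+ \<omega>. ennreal ((norm (qinner (F' \<omega>) u))\<^sup>2) \<partial>M) \<le> ennreal (B * (norm u)\<^sup>2)" for u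
    using upper[of "\<iota> u"] by (simp only: inner isometry)
  ultimately show ?thesis
    unfolding continuous_K_frame_def using AB by blast
qed

theorem corollary1:
  fixes M :: "'w measure"
    and K1 :: "'a::right_quat_hilbert \<Rightarrow> 'a"
    and K2 :: "'b::right_quat_hilbert \<Rightarrow> 'b"
    and F1 :: "'w \<Rightarrow> 'a"
    and F2 :: "'w \<Rightarrow> 'b"
  assumes "bounded_qlinear K1"
    and "bounded_qlinear K2"
    and "continuous_K_frame M (map_prod K1 K2) (\<lambda>\<omega>. (F1 \<omega>, F2 \<omega>))"
  shows "continuous_K_frame M K1 F1 \<and> continuous_K_frame M K2 F2"
proof
  show "continuous_K_frame M K1 F1"
    by (rule continuous_K_frame_restrict[OF assms(3), where \<iota> = "\<lambda>u. (u, 0)"])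
      (simp_all add: qinner_prod_def qadjoint_map_prod[OF assms(1,2)] norm_prod_def)
  show "continuous_K_frame M K2 F2"
    by (rule continuous_K_frame_restrict[OF assms(3), where \<iota> = "\<lambda>v. (0, v)"])
      (simp_all add: qinner_prod_def qadjoint_map_prod[OF assms(1,2)] norm_prod_def)
qed

end
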